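(* Let $(G,P,p,\theta)$ be a social network and let $top\in P$ be a product. Let $[top]$ denote the constant function assigning $\{top\}$ to every node of $G$. Then the social network $(G,P,[top],\theta)$ is unavoidable from $(G,P,p,\theta)$ if and only if all of the following hold: (1) for all nodes $i$, if $N(i)=\emptyset$ (in $G$), then $p(i)=\{top\}$; (2) for all nodes $i$, $top\in p(i)$; (3) the weighted directed graph $G_{p,top}$ is $\theta$-well-structured.
   Context: Setting. $G=(V,E)$ is a finite weighted directed graph with no parallel edges and no self-loops, $n=|V|$, and each edge $(i,j)$ has a weight $w_{ij}\in[0,1]$. For a node $i$, $N(i)$ is the set of nodes $j$ with an edge $(j,i)\in E$ (the neighbours of $i$). It is assumed that $\sum_{j\in N(i)} w_{ji}\le 1$ for every node $i$ with $N(i)\ne\emptyset$. The threshold function $\theta$ assigns to each node $i$ a value $\theta(i)\in(0,1]$. $P$ is a finite set of products. A social network is a tuple $(G,P,p,\theta)$ where $p$ assigns to each node a non-empty subset of $P$; since $G,P,\theta$ are fixed, a social network is identified with $p$. Reductions. For a product $t$ and a node $i$, the adoption condition $A(t,i)$ holds in $p$ if $N(i)=\emptyset$, or if $N(i)\neq\emptyset$ and $\sum_{j\in N(i)\mid p(j)=\{t\}} w_{ji}\ge\theta(i)$. Write $p_1\to p_2$ if $p_2\ne p_1$ and for all nodes $i$ with $p_2(i)\ne p_1(i)$ we have $|p_1(i)|\ge 2$ and, for some $t\in p_1(i)$, $p_2(i)=\{t\}$ and $A(t,i)$ holds in $p_1$. Let $\to^*$ be the reflexive, transitive closure of $\to$.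 A reduction sequence $p\to^* p'$ is maximal if there is no $p''$ with $p'\to p''$. A network $p'$ is unavoidable from $p$ if for all maximal reduction sequences $p\to^* p''$ we have $p'=p''$. The graph $G_{p,t}$ is obtained from $G$ by removing all edges into nodes $i$ with $p(i)=\{t\}$ (so such nodes have no neighbours in $G_{p,t}$, and all other nodes have the same neighbours as in $G$, with the same weights). A weighted directed graph is $\theta$-well-structured if there is a function $level$ from its nodes to the natural numbers such that for every node $i$ with $N(i)\ne\emptyset$ (neighbours taken in that graph), $\sum_{j\in N(i)\mid level(j)<level(i)} w_{ji}\ge\theta(i)$. *)

theory Defs
  imports Complex_Main "HOL-Library.FuncSet" "Graph_Theory.Pair_Digraph"
begin

definition neighbours :: "'v pair_pre_digraph \<Rightarrow> 'v \<Rightarrow> 'v set" where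
  "neighbours G i = {j. (j, i) \<in> parcs G}"

text \<open>Product assignments are taken to be \<open>undefined\<close> outside the node set, so that
  equality of networks is equality on all nodes.\<close>

definition networks :: "'v pair_pre_digraph \<Rightarrow> 'a set \<Rightarrow> ('v \<Rightarrow> 'a set) set" where
  "networks G P = (pverts G \<rightarrow>\<^sub>E Pow P - {{}})"

definition const_network :: "'v pair_pre_digraph \<Rightarrow> 'a \<Rightarrow> 'v \<Rightarrow> 'a set" where
  "const_network G t = (\<lambda>i\<in>pverts G. {t})"

text \<open>The locale \<open>pair_digraph\<close> provides finiteness and absence of self-loops; there are no
  parallel edges because edges are pairs. The weight of the edge \<open>(j, i)\<close> is \<open>w j i\<close>.\<close>

locale weighted_digraph = pair_digraph G
  for G :: "'v pair_pre_digraph" +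
  fixes w :: "'v \<Rightarrow> 'v \<Rightarrow> real"
  assumes weight_range: "(j, i) \<in> parcs G \<Longrightarrow> 0 \<le> w j i \<and> w j i \<le> 1"
    and weight_sum: "\<lbrakk>i \<in> pverts G; neighbours G i \<noteq> {}\<rbrakk> \<Longrightarrow> (\<Sum>j\<in>neighbours G i. w j i) \<le> 1"

locale social_network = weighted_digraph G w
  for G :: "'v pair_pre_digraph" and w :: "'v \<Rightarrow> 'v \<Rightarrow> real" +
  fixes P :: "'a set" and p :: "'v \<Rightarrow> 'a set" and \<theta> :: "'v \<Rightarrow> real"
  assumes finite_products: "finite P"
    and network: "p \<in> networks G P"
    and threshold_range: "i \<in> pverts G \<Longrightarrow> 0 < \<theta> i \<and> \<theta> i \<le> 1"

definition adoption_condition ::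
  "'v pair_pre_digraph \<Rightarrow> ('v \<Rightarrow> 'v \<Rightarrow> real) \<Rightarrow> ('v \<Rightarrow> real) \<Rightarrow> ('v \<Rightarrow> 'a set) \<Rightarrow> 'a \<Rightarrow> 'v \<Rightarrow> bool" where
  "adoption_condition G w \<theta> p t i \<longleftrightarrow>
     neighbours G i = {} \<or>
     neighbours G i \<noteq> {} \<and> (\<Sum>j | j \<in> neighbours G i \<and> p j = {t}. w j i) \<ge> \<theta> i"

definition reduces ::
  "'v pair_pre_digraph \<Rightarrow> ('v \<Rightarrow> 'v \<Rightarrow> real) \<Rightarrow> 'a set \<Rightarrow> ('v \<Rightarrow> real) \<Rightarrow>
   ('v \<Rightarrow> 'a set) \<Rightarrow> ('v \<Rightarrow> 'a set) \<Rightarrow> bool" where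
  "reduces G w P \<theta> p\<^sub>1 p\<^sub>2 \<longleftrightarrow>
     p\<^sub>1 \<in> networks G P \<and> p\<^sub>2 \<in> networks G P \<and> p\<^sub>2 \<noteq> p\<^sub>1 \<and>
     (\<forall>i\<in>pverts G. p\<^sub>2 i \<noteq> p\<^sub>1 i \<longrightarrow>
        card (p\<^sub>1 i) \<ge> 2 \<and> (\<exists>t\<in>p\<^sub>1 i. p\<^sub>2 i = {t} \<and> adoption_condition G w \<theta> p\<^sub>1 t i))"

definition maximal_reduction ::
  "'v pair_pre_digraph \<Rightarrow> ('v \<Rightarrow> 'v \<Rightarrow> real) \<Rightarrow> 'a set \<Rightarrow> ('v \<Rightarrow> real) \<Rightarrow>
   ('v \<Rightarrow> 'a set) \<Rightarrow> ('v \<Rightarrow> 'a set) \<Rightarrow> bool" where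
  "maximal_reduction G w P \<theta> p p' \<longleftrightarrow>
     (reduces G w P \<theta>)\<^sup>*\<^sup>* p p' \<and> \<not> (\<exists>p''. reduces G w P \<theta> p' p'')"

definition unavoidable ::
  "'v pair_pre_digraph \<Rightarrow> ('v \<Rightarrow> 'v \<Rightarrow> real) \<Rightarrow> 'a set \<Rightarrow> ('v \<Rightarrow> real) \<Rightarrow>
   ('v \<Rightarrow> 'a set) \<Rightarrow> ('v \<Rightarrow> 'a set) \<Rightarrow> bool" where
  "unavoidable G w P \<theta> p p' \<longleftrightarrow> (\<forall>p''. maximal_reduction G w P \<theta> p p'' \<longrightarrow> p' = p'')"

definition adoption_graph ::
  "'v pair_pre_digraph \<Rightarrow> ('v \<Rightarrow> 'a set) \<Rightarrow> 'a \<Rightarrow> 'v pair_pre_digraph" where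
  "adoption_graph G p t = G\<lparr>parcs := {(j, i). (j, i) \<in> parcs G \<and> p i \<noteq> {t}}\<rparr>"

definition well_structured ::
  "'v pair_pre_digraph \<Rightarrow> ('v \<Rightarrow> 'v \<Rightarrow> real) \<Rightarrow> ('v \<Rightarrow> real) \<Rightarrow> bool" where
  "well_structured G w \<theta> \<longleftrightarrow>
     (\<exists>level :: 'v \<Rightarrow> nat. \<forall>i\<in>pverts G. neighbours G i \<noteq> {} \<longrightarrow>
        (\<Sum>j | j \<in> neighbours G i \<and> level j < level i. w j i) \<ge> \<theta> i)"

end

(* If (1)-(3) hold, every node along a reduction sequence either keeps its initial set or holds
   {tp}: the first node to adopt another product s would need, thresholds being positive, a
   neighbour that held {s} from the start. By induction on levels, every node of a network that
   admits no further reduction then holds {tp}.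
   If [tp] is unavoidable, levels are built backwards along a reduction sequence ending in [tp]:
   undoing a step moves all nodes that do not yet hold {tp} one level up and puts all others on
   level 0. *)

theory Submission
  imports Defs
begin

section \<open>Reductions in general: steps, monotonicity, termination\<close>

lemma neighbours_adoption_graph:
  "neighbours (adoption_graph G p t) i = (if p i = {t} then {} else neighbours G i)"
  by (auto simp: neighbours_def adoption_graph_def)

lemma pverts_adoption_graph [simp]: "pverts (adoption_graph G p t) = pverts G"
  by (simp add: adoption_graph_def)

lemma networks_nonempty: "q \<in> networks G P \<Longrightarrow> i \<in> pverts G \<Longrightarrow> q i \<noteq> {}"
  by (auto simp: networks_def PiE_iff)

lemma networks_subset: "q \<in> networks G P \<Longrightarrow> i \<in> pverts G \<Longrightarrow> q i \<subseteq> P"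
  by (auto simp: networks_def PiE_iff)

lemma networks_eqI:
  assumes "q \<in> networks G P" "q' \<in> networks G P" "\<And>i. i \<in> pverts G \<Longrightarrow> q i = q' i"
  shows "q = q'"
  using assms PiE_ext unfolding networks_def by blast

lemma const_network_in_networks: "t \<in> P \<Longrightarrow> const_network G t \<in> networks G P"
  by (auto simp: const_network_def networks_def)

text \<open>Elimination rule for one node: since the set changes, the cardinality bound can be
  traded for \<open>q i \<noteq> {t}\<close>.\<close>

lemma reduces_cases:
  assumes "reduces G w P \<theta> q q'" "i \<in> pverts G"
  obtains "q' i = q i"
  | t where "t \<in> q i" "q i \<noteq> {t}" "q' i = {t}" "adoption_condition G w \<theta> q t i"
proof (cases "q' i = q i")
  case False
  then have "card (q i) \<ge> 2"
    and "\<exists>t\<in>q i. q' i = {t} \<and> adoption_condition G w \<theta> q t i"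
    using assms unfolding reduces_def by blast+
  then show ?thesis using False that(2) by metis
qed (rule that(1))

lemma reduces_singleton:
  assumes "reduces G w P \<theta> q q'" "i \<in> pverts G" "q i = {t}"
  shows "q' i = {t}"
  using assms by (auto elim: reduces_cases)

lemma rtranclp_reduces_singleton:
  assumes "(reduces G w P \<theta>)\<^sup>*\<^sup>* q q'" "i \<in> pverts G" "q i = {t}"
  shows "q' i = {t}"
  using assms by (induction) (auto dest: reduces_singleton)

lemma rtranclp_reduces_subset:
  assumes "(reduces G w P \<theta>)\<^sup>*\<^sup>* q q'" "i \<in> pverts G"
  shows "q' i \<subseteq> q i"
  using assms
proof induction
  case (step y z)
  from step.hyps(2) step.prems have "z i \<subseteq> y i"
    by (rule reduces_cases) auto
  then show ?case using step by blast
qed simp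

lemma rtranclp_reduces_networks:
  assumes "(reduces G w P \<theta>)\<^sup>*\<^sup>* q q'" "q \<in> networks G P"
  shows "q' \<in> networks G P"
  using assms by induction (auto simp: reduces_def)

text \<open>Builds a step that moves a single node. Finiteness of \<open>P\<close> turns
  \<open>q i \<noteq> {t}\<close> back into the cardinality bound, as \<open>card\<close> is 0 on
  infinite sets.\<close>

lemma reduces_fun_upd:
  assumes "finite P" "q \<in> networks G P" "i \<in> pverts G" "t \<in> q i" "q i \<noteq> {t}"
    and "adoption_condition G w \<theta> q t i"
  shows "reduces G w P \<theta> q (q(i := {t}))"
proof -
  have "q i \<subseteq> P" using assms(2,3) by (rule networks_subset)
  then have "finite (q i)" using \<open>finite P\<close> finite_subset by blast
  moreover have "{t} \<subset> q i" using assms by blast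
  ultimately have "card {t} < card (q i)" by (rule psubset_card_mono)
  then have "card (q i) \<ge> 2" by simp
  moreover have "q(i := {t}) \<in> networks G P"
    using assms(2,3,4) \<open>q i \<subseteq> P\<close> unfolding networks_def
    by (auto simp: PiE_iff extensional_def)
  moreover have "q(i := {t}) \<noteq> q" using assms(5) by (metis fun_upd_same)
  ultimately show ?thesis using assms unfolding reduces_def by auto
qed

text \<open>Termination measure: no set grows in a step, and two distinct networks differ at some
  node, where the set shrinks properly.\<close>

lemma reduces_sum_card_less:
  assumes "finite P" "finite (pverts G)" "reduces G w P \<theta> q q'"
  shows "(\<Sum>i\<in>pverts G. card (q' i)) < (\<Sum>i\<in>pverts G. card (q i))"
proof (rule sum_strict_mono_ex1)
  have nets: "q \<in> networks G P" "q' \<in> networks G P" and "q' \<noteq> q"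
    using assms(3) by (auto simp: reduces_def)
  have sub: "q' i \<subseteq> q i" and fin: "finite (q i)" if "i \<in> pverts G" for i
    using rtranclp_reduces_subset[OF r_into_rtranclp[of "reduces G w P \<theta>", OF assms(3)] that]
      networks_subset[OF nets(1) that] \<open>finite P\<close> finite_subset by blast+
  then show "\<forall>i\<in>pverts G. card (q' i) \<le> card (q i)"
    by (simp add: card_mono)
  obtain i where "i \<in> pverts G" "q' i \<noteq> q i"
    using networks_eqI[OF nets] \<open>q' \<noteq> q\<close> by metis
  then show "\<exists>i\<in>pverts G. card (q' i) < card (q i)"
    using sub fin by (metis psubsetI psubset_card_mono)
qed (rule assms)

lemma maximal_reduction_exists:
  assumes "finite P" "finite (pverts G)"
  shows "\<exists>q'. maximal_reduction G w P \<theta> q q'"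
proof (induction "\<Sum>i\<in>pverts G. card (q i)" arbitrary: q rule: less_induct)
  case less
  show ?case
  proof (cases "\<exists>r. reduces G w P \<theta> q r")
    case True
    then obtain r where r: "reduces G w P \<theta> q r" by blast
    then obtain q' where "maximal_reduction G w P \<theta> r q'"
      using less reduces_sum_card_less[OF assms r] by blast
    then show ?thesis
      using r unfolding maximal_reduction_def by (meson converse_rtranclp_into_rtranclp)
  qed (auto simp: maximal_reduction_def)
qed

lemma maximal_reduction_prepend:
  "(reduces G w P \<theta>)\<^sup>*\<^sup>* q r \<Longrightarrow> maximal_reduction G w P \<theta> r q' \<Longrightarrow> maximal_reduction G w P \<theta> q q'"
  unfolding maximal_reduction_def by auto

section \<open>Level functions obtained from reductions\<close>

context weighted_digraph
begin

lemma neighbours_subset_pverts: "neighbours G i \<subseteq> pverts G"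
  by (auto simp: neighbours_def dest: in_arcsD1)

lemma finite_neighbours: "finite (neighbours G i)"
  using neighbours_subset_pverts finite_verts by (rule finite_subset)

lemma sum_weights_mono:
  assumes "A \<subseteq> B" "B \<subseteq> neighbours G i"
  shows "(\<Sum>j\<in>A. w j i) \<le> (\<Sum>j\<in>B. w j i)"
proof (rule sum_mono2)
  show "finite B" using assms(2) finite_neighbours finite_subset by blast
  show "0 \<le> w j i" if "j \<in> B - A" for j
    using that assms(2) weight_range[of j i] by (auto simp: neighbours_def)
qed (rule assms)

text \<open>Undoing a step restores the edges into the nodes that adopted \<open>t\<close> in it;
  their adoption condition supplies the level inequality.\<close>

lemma well_structured_backward_step:
  assumes "reduces G w P \<theta> q q'" and "well_structured (adoption_graph G q' t) w \<theta>"
  shows "well_structured (adoption_graph G q t) w \<theta>"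
proof -
  obtain level :: "'v \<Rightarrow> nat" where level:
    "\<And>i. \<lbrakk>i \<in> pverts G; q' i \<noteq> {t}; neighbours G i \<noteq> {}\<rbrakk> \<Longrightarrow>
      \<theta> i \<le> (\<Sum>j | j \<in> neighbours G i \<and> level j < level i. w j i)"
    using assms(2) unfolding well_structured_def
    by (auto simp: neighbours_adoption_graph split: if_splits)
  \<comment> \<open>The shift by \<open>Suc\<close> leaves level 0 to the nodes that hold
    \<open>{t}\<close> before the step, strictly below all others.\<close>
  define level' where "level' i = (if q i = {t} then 0 else Suc (level i))" for i
  have "\<theta> i \<le> (\<Sum>j | j \<in> neighbours G i \<and> level' j < level' i. w j i)"
    if i: "i \<in> pverts G" "q i \<noteq> {t}" "neighbours G i \<noteq> {}" for i
  proof (cases "q' i = {t}")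
    case True
    have "adoption_condition G w \<theta> q t i"
      using assms(1) i(1) by (cases rule: reduces_cases) (use True i in auto)
    then have "\<theta> i \<le> (\<Sum>j | j \<in> neighbours G i \<and> q j = {t}. w j i)"
      using i by (simp add: adoption_condition_def)
    also have "\<dots> \<le> (\<Sum>j | j \<in> neighbours G i \<and> level' j < level' i. w j i)"
      by (rule sum_weights_mono) (use i in \<open>auto simp: level'_def\<close>)
    finally show ?thesis .
  next
    case False
    then have "\<theta> i \<le> (\<Sum>j | j \<in> neighbours G i \<and> level j < level i. w j i)"
      using i level by blast
    \<comment> \<open>\<open>level' j\<close> is 0 or \<open>Suc (level j)\<close>, so neighbours of
      lower level stay lower.\<close>
    also have "\<dots> \<le> (\<Sum>j | j \<in> neighbours G i \<and> level' j < level' i. w j i)"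
      by (rule sum_weights_mono) (use i in \<open>auto simp: level'_def\<close>)
    finally show ?thesis .
  qed
  then show ?thesis
    unfolding well_structured_def
    by (intro exI[of _ level']) (auto simp: neighbours_adoption_graph)
qed

text \<open>Backward induction from the constant network, whose adoption graph has no edges, so that
  any level function serves there.\<close>

lemma well_structured_if_reaches_const:
  assumes "(reduces G w P \<theta>)\<^sup>*\<^sup>* q (const_network G t)"
  shows "well_structured (adoption_graph G q t) w \<theta>"
  using assms
proof (induction rule: converse_rtranclp_induct)
  case base
  show ?case
    by (auto simp: well_structured_def neighbours_adoption_graph const_network_def)
qed (rule well_structured_backward_step)

end

section \<open>Both directions of the characterisation\<close>

context social_network
begin

text \<open>Unavoidability only quantifies over maximal reductions; termination provides one, so it
  is not vacuous.\<close>

lemma reaches_unavoidable: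
  assumes "unavoidable G w P \<theta> p q"
  shows "(reduces G w P \<theta>)\<^sup>*\<^sup>* p q"
  using assms maximal_reduction_exists[OF finite_products finite_verts, of w \<theta> p]
  by (auto simp: unavoidable_def maximal_reduction_def)

text \<open>A node without neighbours may adopt any product it holds, and a singleton never changes
  again. Adopting some \<open>s \<noteq> t\<close> would thus lead to a maximal network other than
  the constant one.\<close>

lemma source_if_unavoidable:
  assumes unav: "unavoidable G w P \<theta> p (const_network G t)"
    and i: "i \<in> pverts G" "neighbours G i = {}"
  shows "p i = {t}"
proof (rule ccontr)
  assume "p i \<noteq> {t}"
  then obtain s where s: "s \<in> p i" "s \<noteq> t"
    using networks_nonempty[OF network i(1)] by blast
  have "\<exists>r. (reduces G w P \<theta>)\<^sup>*\<^sup>* p r \<and> r i = {s}"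
  proof (cases "p i = {s}")
    case False
    have "reduces G w P \<theta> p (p(i := {s}))"
      using finite_products network i(1) s(1) False
      by (rule reduces_fun_upd) (simp add: adoption_condition_def i)
    then show ?thesis by (intro exI[of _ "p(i := {s})"]) auto
  qed blast
  then obtain r where r: "(reduces G w P \<theta>)\<^sup>*\<^sup>* p r" "r i = {s}" by blast
  obtain q where q: "maximal_reduction G w P \<theta> r q"
    using maximal_reduction_exists[OF finite_products finite_verts] by blast
  then have "(reduces G w P \<theta>)\<^sup>*\<^sup>* r q" by (simp add: maximal_reduction_def)
  then have "q i = {s}" using i(1) r(2) by (rule rtranclp_reduces_singleton)
  moreover have "q = const_network G t"
    using unav maximal_reduction_prepend[OF r(1) q] by (simp add: unavoidable_def)
  ultimately show False using i(1) s(2) by (simp add: const_network_def)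
qed

text \<open>Adopting \<open>s \<noteq> t\<close> takes a neighbour that already holds
  \<open>{s}\<close>. By induction it held \<open>{s}\<close> from the start, although
  \<open>t\<close> lies in every initial set.\<close>

lemma reachable_initial_or_singleton:
  assumes "(reduces G w P \<theta>)\<^sup>*\<^sup>* p q"
    and sources: "\<And>i. i \<in> pverts G \<Longrightarrow> neighbours G i = {} \<Longrightarrow> p i = {t}"
    and mem: "\<And>i. i \<in> pverts G \<Longrightarrow> t \<in> p i"
    and "i \<in> pverts G"
  shows "q i = p i \<or> q i = {t}"
  using assms(1,4)
proof (induction arbitrary: i)
  case (step y z)
  from step.hyps(2) step.prems show ?case
  proof (cases rule: reduces_cases)
    case 1
    then show ?thesis using step by metis
  next
    case (2 s)
    have "s = t"
    proof (rule ccontr)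
      assume "s \<noteq> t"
      \<comment> \<open>Otherwise the induction hypothesis gives \<open>y i = {t}\<close>, which
        excludes \<open>s \<in> y i\<close>.\<close>
      have "p i \<noteq> {t}"
        using step.IH[OF step.prems] 2 by auto
      then have "neighbours G i \<noteq> {}" using sources step.prems by blast
      then have "\<theta> i \<le> (\<Sum>j | j \<in> neighbours G i \<and> y j = {s}. w j i)"
        using 2 by (simp add: adoption_condition_def)
      moreover have "\<theta> i > 0" using threshold_range step.prems by blast
      \<comment> \<open>An empty sum is 0 and cannot meet a positive threshold.\<close>
      ultimately have "{j \<in> neighbours G i. y j = {s}} \<noteq> {}"
        by (metis (no_types, lifting) linorder_not_less sum.empty)
      then obtain j where "j \<in> pverts G" "y j = {s}"
        using neighbours_subset_pverts by blast
      then have "p j = {s}" using step.IH[of j] \<open>s \<noteq> t\<close> by auto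
      then show False using mem[OF \<open>j \<in> pverts G\<close>] \<open>s \<noteq> t\<close> by simp
    qed
    then show ?thesis using 2 by simp
  qed
qed simp

text \<open>Strong induction on levels: once all lower nodes hold \<open>{t}\<close>, a node that
  does not could still adopt \<open>t\<close>, against maximality.\<close>

lemma maximal_reduction_const:
  assumes maxi: "maximal_reduction G w P \<theta> p q"
    and sources: "\<And>i. i \<in> pverts G \<Longrightarrow> neighbours G i = {} \<Longrightarrow> p i = {t}"
    and mem: "\<And>i. i \<in> pverts G \<Longrightarrow> t \<in> p i"
    and ws: "well_structured (adoption_graph G p t) w \<theta>"
    and "i \<in> pverts G"
  shows "q i = {t}"
proof -
  have reach: "(reduces G w P \<theta>)\<^sup>*\<^sup>* p q" and stuck: "\<And>r. \<not> reduces G w P \<theta> q r"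
    using maxi by (auto simp: maximal_reduction_def)
  obtain level :: "'v \<Rightarrow> nat" where level:
    "\<And>i. \<lbrakk>i \<in> pverts G; p i \<noteq> {t}; neighbours G i \<noteq> {}\<rbrakk> \<Longrightarrow>
      \<theta> i \<le> (\<Sum>j | j \<in> neighbours G i \<and> level j < level i. w j i)"
    using ws unfolding well_structured_def
    by (auto simp: neighbours_adoption_graph split: if_splits)
  show ?thesis using \<open>i \<in> pverts G\<close>
  proof (induction "level i" arbitrary: i rule: less_induct)
    case (less i)
    show ?case
    proof (rule ccontr)
      assume qi: "q i \<noteq> {t}"
      \<comment> \<open>The node still has its initial set, so \<open>p i \<noteq> {t}\<close> and
        the level inequality for the adoption graph of \<open>p\<close> applies to it.\<close>
      then have eq: "q i = p i"
        using reachable_initial_or_singleton[OF reach sources mem less.prems] by blast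
      then have ne: "neighbours G i \<noteq> {}" using sources less.prems qi by metis
      have "\<theta> i \<le> (\<Sum>j | j \<in> neighbours G i \<and> level j < level i. w j i)"
        using level less.prems qi eq ne by metis
      also have "\<dots> \<le> (\<Sum>j | j \<in> neighbours G i \<and> q j = {t}. w j i)"
        by (rule sum_weights_mono) (use less.hyps neighbours_subset_pverts in auto)
      finally have "adoption_condition G w \<theta> q t i"
        using ne by (simp add: adoption_condition_def)
      then show False
        using stuck reduces_fun_upd[OF finite_products rtranclp_reduces_networks[OF reach network]]
          less.prems mem eq qi by metis
    qed
  qed
qed

lemma unavoidable_const_network_iff:
  assumes "t \<in> P"
  shows "unavoidable G w P \<theta> p (const_network G t) \<longleftrightarrow>
    (\<forall>i\<in>pverts G. neighbours G i = {} \<longrightarrow> p i = {t}) \<and>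
    (\<forall>i\<in>pverts G. t \<in> p i) \<and>
    well_structured (adoption_graph G p t) w \<theta>"
    (is "?U \<longleftrightarrow> ?S \<and> ?M \<and> ?W")
proof
  assume U: ?U
  note reach = reaches_unavoidable[OF U]
  have ?S using source_if_unavoidable[OF U] by blast
  \<comment> \<open>Sets only shrink along a reduction, so the final \<open>{t}\<close> lies in
    every initial set.\<close>
  moreover have ?M
    using rtranclp_reduces_subset[OF reach] by (auto simp: const_network_def)
  moreover have ?W using reach by (rule well_structured_if_reaches_const)
  ultimately show "?S \<and> ?M \<and> ?W" by blast
next
  assume R: "?S \<and> ?M \<and> ?W"
  show ?U
    unfolding unavoidable_def
  proof (intro allI impI)
    fix q assume q: "maximal_reduction G w P \<theta> p q"
    then have "q \<in> networks G P"
      using rtranclp_reduces_networks network by (auto simp: maximal_reduction_def)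
    with const_network_in_networks[OF assms] show "const_network G t = q"
    proof (rule networks_eqI)
      fix i assume "i \<in> pverts G"
      then show "const_network G t i = q i"
        using maximal_reduction_const[OF q] R by (auto simp: const_network_def)
    qed
  qed
qed

end

theorem theorem4:
  fixes G :: "'v pair_pre_digraph" and w :: "'v \<Rightarrow> 'v \<Rightarrow> real"
    and P :: "'a set" and p :: "'v \<Rightarrow> 'a set" and \<theta> :: "'v \<Rightarrow> real" and tp :: 'a
  assumes "social_network G w P p \<theta>"
    and "tp \<in> P"
  shows "unavoidable G w P \<theta> p (const_network G tp) \<longleftrightarrow>
    (\<forall>i\<in>pverts G. neighbours G i = {} \<longrightarrow> p i = {tp}) \<and>
    (\<forall>i\<in>pverts G. tp \<in> p i) \<and>
    well_structured (adoption_graph G p tp) w \<theta>"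
  using assms by (rule social_network.unavoidable_const_network_iff)

end
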